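(* Let $\alpha$ be irrational with bounded partial quotients $a_n$, let $C:=\sup_{n\ge1}a_n+1$, and let $Tx=x+\alpha$ on $\mathbb{T}=\mathbb{R}/\mathbb{Z}$. Let $P\subset\mathbb{R}\setminus\{0\}$ be a nonempty compact set and let $0<\eta<\frac12$ be such that $P\subset\mathbb{R}\setminus(-\eta,\eta)$. Let $f\in L^\infty(\mathbb{T})$ be a roof function with $f\ge c$ for some constant $c>0$. Assume that the special flow $(T^f_t)_{t\in\mathbb{R}}$ over $T$ under $f$ satisfies the cocycle Ratner's property with the set $P$ in the following strong form: there exist constants $R_1,R_2>0$ such that for every $\epsilon>0$ and $N\in\mathbb{N}$ there are $\kappa=\kappa(\epsilon)>0$ (depending only on $\epsilon$) and $\delta=\delta(\epsilon,N)>0$ such that for all $x,x'\in\mathbb{T}$ with $0<\|x-x'\|<\delta$ there are $M=M(\epsilon,N,x,x')\ge N$, $L=L(\epsilon,N,x,x')\ge N$ and $p=p(\epsilon,N,x,x')\in P$ with $\frac{L}{M}\ge\kappa$, $$R_1\le M\,\|x-x'\|\le R_2,$$ and $|f^{(n)}(x)-f^{(n)}(x')-p|<\epsilon$ for every $n\in\mathbb{Z}\cap[M,M+L]$. Then for every function $g:\mathbb{T}\to\mathbb{R}$ of bounded variation with $\mathrm{Var}\,g<\frac{1}{8CR_2}\eta$ (and such that $f+g$ is bounded below by a positive constant, so that the special flow is defined), the special flow $(T^{f+g}_t)_{t\in\mathbb{R}}$ has the cocycle Ratner's property with some compact set $P'\subset\mathbb{R}\setminus\{0\}$.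
   Context: $\mathbb{T}=\mathbb{R}/\mathbb{Z}$ carries Lebesgue (Haar) measure $\lambda$ and the metric $d(x,y)=\|x-y\|$, where $\|\cdot\|$ is the distance to the nearest integer. The $a_n$ are the partial quotients of the continued fraction $\alpha=[0;a_1,a_2,\dots]$. For $n\ge1$, $h^{(n)}(x)=h(x)+h(Tx)+\dots+h(T^{n-1}x)$. $\mathrm{Var}\,g$ is the total variation of $g$ on $\mathbb{T}$. The special flow $(T^h_t)$ over $T$ under a roof function $h\ge c>0$ acts on $\{(x,s):x\in\mathbb{T},\,0\le s<h(x)\}$ by moving points vertically at unit speed with the identification $(x,h(x))\sim(Tx,0)$. **Cocycle Ratner's property.** Let $P\subset\mathbb{R}\setminus\{0\}$ be compact. The special flow $(T^h_t)$ given by $T$ and $h$ has the cocycle Ratner's property with the set $P$ if for every $\epsilon>0$ and $N\in\mathbb{N}$ there exist $\kappa=\kappa(\epsilon)>0$ (depending only on $\epsilon$), $\delta=\delta(\epsilon,N)>0$ and a Borel set $Z=Z(\epsilon,N)$ with $\lambda(Z)>1-\epsilon$ such that if $x,x'\in Z$, $0<d(x,x')<\delta$, then there are $M\ge N$, $L\ge N$ (depending on $\epsilon,N,x,x'$) with $\frac LM\ge\kappa$ and $p\in P$ (depending on $\epsilon,N,x,x'$) such that $$\frac1L\left|\{n\in\mathbb{Z}\cap[M,M+L]:\ |h^{(n)}(x)-h^{(n)}(x')-p|<\epsilon\}\right|>1-\epsilon.$$ *)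

theory Defs
  imports "HOL-Analysis.Analysis"
begin

section \<open>The circle group \<open>\<real>/\<int>\<close>\<close>

quotient_type circle = real / "\<lambda>x y. x - y \<in> \<int>"
  morphisms rep_circle to_circle
proof (rule equivpI)
  show "reflp (\<lambda>x y::real. x - y \<in> \<int>)"
    by (auto intro: reflpI)
  show "symp (\<lambda>x y::real. x - y \<in> \<int>)"
    by (rule sympI) (metis Ints_minus minus_diff_eq)
  show "transp (\<lambda>x y::real. x - y \<in> \<int>)"
  proof (rule transpI)
    fix x y z :: real
    assume "x - y \<in> \<int>" "y - z \<in> \<int>"
    then have "(x - y) + (y - z) \<in> \<int>"
      by (rule Ints_add)
    then show "x - z \<in> \<int>"
      by simp
  qed
qed

text \<open>Distance of a real number to the nearest integer.\<close>

definition nearest_int_dist :: "real \<Rightarrow> real"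
  where "nearest_int_dist x = \<bar>x - of_int (round x)\<bar>"

lemma nearest_int_dist_le: "nearest_int_dist x \<le> \<bar>x - of_int m\<bar>"
  unfolding nearest_int_dist_def by (rule round_diff_minimal)

lemma nearest_int_dist_nonneg: "0 \<le> nearest_int_dist x"
  by (simp add: nearest_int_dist_def)

lemma nearest_int_dist_eq_0_iff: "nearest_int_dist x = 0 \<longleftrightarrow> x \<in> \<int>"
  by (auto simp: nearest_int_dist_def elim!: Ints_cases) (metis Ints_of_int)

lemma nearest_int_dist_cong:
  assumes "x - y \<in> \<int>"
  shows "nearest_int_dist x = nearest_int_dist y"
proof -
  have le: "nearest_int_dist a \<le> nearest_int_dist b" if ab: "a - b \<in> \<int>" for a b
  proof -
    obtain k where k: "a - b = of_int k"
      using ab by (auto elim: Ints_cases)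
    have "nearest_int_dist a \<le> \<bar>a - of_int (round b + k)\<bar>"
      by (rule nearest_int_dist_le)
    also have "a - of_int (round b + k) = b - of_int (round b)"
      using k by simp
    finally show ?thesis
      by (simp add: nearest_int_dist_def)
  qed
  have "y - x \<in> \<int>"
    using assms by (metis Ints_minus minus_diff_eq)
  with assms le[of x y] le[of y x] show ?thesis
    by simp
qed

lemma nearest_int_dist_triangle:
  "nearest_int_dist (x + y) \<le> nearest_int_dist x + nearest_int_dist y"
  using nearest_int_dist_le[of "x + y" "round x + round y"]
  by (simp add: nearest_int_dist_def)

lemma nearest_int_dist_minus_commute: "nearest_int_dist (x - y) = nearest_int_dist (y - x)"
proof -
  have le: "nearest_int_dist (a - b) \<le> nearest_int_dist (b - a)" for a b
    using nearest_int_dist_le[of "a - b" "- round (b - a)"]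
    by (simp add: nearest_int_dist_def)
  show ?thesis
    using le[of x y] le[of y x] by simp
qed

instantiation circle :: ab_group_add
begin

lift_definition zero_circle :: circle is 0 .

lift_definition plus_circle :: "circle \<Rightarrow> circle \<Rightarrow> circle" is "(+)"
  by (simp only: add_diff_add Ints_add)

lift_definition uminus_circle :: "circle \<Rightarrow> circle" is uminus
  by (simp only: minus_diff_minus Ints_minus)

lift_definition minus_circle :: "circle \<Rightarrow> circle \<Rightarrow> circle" is "(-)"
proof -
  fix a b c d :: real
  assume "a - b \<in> \<int>" "c - d \<in> \<int>"
  then have "(a - b) - (c - d) \<in> \<int>"
    by (rule Ints_diff)
  moreover have "a - c - (b - d) = (a - b) - (c - d)"
    by simp
  ultimately show "a - c - (b - d) \<in> \<int>"
    by (simp only:)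
qed

instance
  by standard (transfer; simp)+

end

text \<open>The metric \<open>d(x,y) = \<parallel>x - y\<parallel>\<close>; the topology and the Borel sets of the circle are the ones it
  induces.\<close>

instantiation circle :: metric_space
begin

lift_definition dist_circle :: "circle \<Rightarrow> circle \<Rightarrow> real" is "\<lambda>x y. nearest_int_dist (x - y)"
proof (rule nearest_int_dist_cong)
  fix a b c d :: real
  assume "a - b \<in> \<int>" "c - d \<in> \<int>"
  then have "(a - b) - (c - d) \<in> \<int>"
    by (rule Ints_diff)
  moreover have "a - c - (b - d) = (a - b) - (c - d)"
    by simp
  ultimately show "a - c - (b - d) \<in> \<int>"
    by (simp only:)
qed

definition uniformity_circle_def [code del]:
  "(uniformity :: (circle \<times> circle) filter) = (INF e\<in>{0 <..}. principal {(x, y). dist x y < e})"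

definition open_circle_def [code del]:
  "open (U :: circle set) \<longleftrightarrow> (\<forall>x\<in>U. eventually (\<lambda>(x', y). x' = x \<longrightarrow> y \<in> U) uniformity)"

instance
proof
  fix x y z :: circle
  show "dist x y = 0 \<longleftrightarrow> x = y"
    by transfer (rule nearest_int_dist_eq_0_iff)
  show "dist x y \<le> dist x z + dist y z"
  proof transfer
    fix x y z :: real
    show "nearest_int_dist (x - y) \<le> nearest_int_dist (x - z) + nearest_int_dist (y - z)"
      using nearest_int_dist_triangle[of "x - z" "z - y"] nearest_int_dist_minus_commute[of z y]
      by simp
  qed
qed (rule uniformity_circle_def open_circle_def)+

end

lemma dist_to_circle: "dist (to_circle s) (to_circle t) = nearest_int_dist (s - t)"
  by (rule dist_circle.abs_eq)

lemma continuous_on_to_circle: "continuous_on UNIV to_circle"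
proof (clarsimp simp: continuous_on_iff)
  fix x e :: real
  assume "0 < e"
  moreover have "dist (to_circle s) (to_circle x) \<le> dist s x" for s
    using nearest_int_dist_le[of "s - x" 0] by (simp add: dist_to_circle dist_real_def)
  ultimately show "\<exists>d>0. \<forall>s. dist s x < d \<longrightarrow> dist (to_circle s) (to_circle x) < e"
    by (meson le_less_trans)
qed

lemma measurable_to_circle [measurable]: "to_circle \<in> borel_measurable borel"
  by (rule borel_measurable_continuous_onI[OF continuous_on_to_circle])

text \<open>Lebesgue (Haar) probability measure, on the Borel sets of the circle.\<close>

definition circle_lborel :: "circle measure"
  where "circle_lborel = distr (restrict_space lborel {0..<1}) borel to_circle"

lemma sets_circle_lborel [simp, measurable_cong]: "sets circle_lborel = sets borel"
  by (simp add: circle_lborel_def)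

lemma space_circle_lborel [simp]: "space circle_lborel = UNIV"
  by (simp add: circle_lborel_def)

lemma emeasure_circle_lborel:
  assumes "A \<in> sets borel"
  shows "emeasure circle_lborel A = emeasure lborel (to_circle -` A \<inter> {0..<1})"
proof -
  have m: "to_circle \<in> measurable (restrict_space lborel {0..<1}) borel"
    by (rule measurable_restrict_space1) simp
  show ?thesis
    using assms by (simp add: circle_lborel_def emeasure_distr[OF m] emeasure_restrict_space space_restrict_space)
qed

lemma emeasure_circle_lborel_UNIV: "emeasure circle_lborel UNIV = 1"
  by (simp add: emeasure_circle_lborel)


section \<open>Rotations, continued fractions and variation\<close>

definition rotation :: "real \<Rightarrow> circle \<Rightarrow> circle"
  where "rotation \<alpha> x = x + to_circle \<alpha>"

primrec complete_quotient :: "real \<Rightarrow> nat \<Rightarrow> real" where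
  "complete_quotient \<alpha> 0 = \<alpha>"
| "complete_quotient \<alpha> (Suc n) = 1 / frac (complete_quotient \<alpha> n)"

text \<open>The partial quotients \<open>a\<^sub>n\<close> of \<open>\<alpha> = [a\<^sub>0; a\<^sub>1, a\<^sub>2, \<dots>]\<close> for irrational \<open>\<alpha>\<close>. Only
  those with \<open>n \<ge> 1\<close> are used below; they depend only on \<open>\<alpha>\<close> modulo 1, so that \<open>\<alpha>\<close> need
  not be normalised to have \<open>a\<^sub>0 = 0\<close>.\<close>

definition partial_quotient :: "real \<Rightarrow> nat \<Rightarrow> int"
  where "partial_quotient \<alpha> n = \<lfloor>complete_quotient \<alpha> n\<rfloor>"

text \<open>Total variation on the circle, as the supremum over the cyclic partitions
  \<open>t 0 \<le> t 1 \<le> \<dots> \<le> t n = t 0 + 1\<close>; the increment across the closing point is thus included.\<close>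

definition circle_variation :: "(circle \<Rightarrow> real) \<Rightarrow> ereal"
  where "circle_variation g =
    (SUP (n, t) \<in> {(n :: nat, t :: nat \<Rightarrow> real). mono_on {..n} t \<and> t n = t 0 + 1}.
       ereal (\<Sum>k<n. \<bar>g (to_circle (t (Suc k))) - g (to_circle (t k))\<bar>))"

definition birkhoff_sum :: "('a \<Rightarrow> 'a) \<Rightarrow> ('a \<Rightarrow> real) \<Rightarrow> nat \<Rightarrow> 'a \<Rightarrow> real"
  where "birkhoff_sum T h n x = (\<Sum>k<n. h ((T ^^ k) x))"


section \<open>The cocycle Ratner's property\<close>

text \<open>The property of the special flow over \<open>T\<close> under \<open>h\<close> is by definition a condition on the pair
  \<open>(T, h)\<close>. The numbers \<open>M\<close> and \<open>L\<close> are natural numbers; \<open>\<kappa> > 0\<close> forces \<open>M\<close> and \<open>L\<close> to be nonzero,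
  since \<open>L / 0 = 0\<close>.\<close>

definition cocycle_ratner :: "(circle \<Rightarrow> circle) \<Rightarrow> (circle \<Rightarrow> real) \<Rightarrow> real set \<Rightarrow> bool"
  where "cocycle_ratner T h P \<longleftrightarrow>
    (\<forall>\<epsilon>>0. \<exists>\<kappa>>0. \<forall>N::nat. \<exists>\<delta>>0. \<exists>Z\<in>sets borel.
       measure circle_lborel Z > 1 - \<epsilon> \<and>
       (\<forall>x\<in>Z. \<forall>x'\<in>Z. 0 < dist x x' \<and> dist x x' < \<delta> \<longrightarrow>
          (\<exists>M\<ge>N. \<exists>L\<ge>N. \<exists>p\<in>P.
             real L / real M \<ge> \<kappa> \<and>
             real (card {n \<in> {M..M + L}.
                     \<bar>birkhoff_sum T h n x - birkhoff_sum T h n x' - p\<bar> < \<epsilon>}) / real L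
               > 1 - \<epsilon>)))"

definition strong_cocycle_ratner ::
    "(circle \<Rightarrow> circle) \<Rightarrow> (circle \<Rightarrow> real) \<Rightarrow> real set \<Rightarrow> real \<Rightarrow> real \<Rightarrow> bool"
  where "strong_cocycle_ratner T h P R\<^sub>1 R\<^sub>2 \<longleftrightarrow>
    (\<forall>\<epsilon>>0. \<exists>\<kappa>>0. \<forall>N::nat. \<exists>\<delta>>0.
       \<forall>x x'. 0 < dist x x' \<and> dist x x' < \<delta> \<longrightarrow>
         (\<exists>M\<ge>N. \<exists>L\<ge>N. \<exists>p\<in>P.
            real L / real M \<ge> \<kappa> \<and>
            R\<^sub>1 \<le> real M * dist x x' \<and> real M * dist x x' \<le> R\<^sub>2 \<and>
            (\<forall>n\<in>{M..M + L}.
               \<bar>birkhoff_sum T h n x - birkhoff_sum T h n x' - p\<bar> < \<epsilon>)))"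

end

theory Submission
  imports Defs
begin

text \<open>
  Fix a pair \<open>x, x'\<close> at small distance \<open>d\<close> and let \<open>F n\<close>, \<open>G n\<close> be the differences of the \<open>n\<close>-th
  Birkhoff sums of \<open>f\<close> and \<open>g\<close> at \<open>x\<close> and \<open>x'\<close>. On a long window of times \<open>n\<close>, comparable with
  \<open>1 / d\<close>, the sequence \<open>F\<close> is almost a constant \<open>p\<close> with \<open>\<bar>p\<bar> \<ge> \<eta>\<close>, and a window of this kind is wanted
  for \<open>F + G\<close>. What is known about \<open>g\<close> enters only through the total variation of the sequence \<open>G\<close>:
  since \<open>\<alpha>\<close> is of bounded type, an arc of length \<open>d\<close> does not overlap its translates for a time of at
  least \<open>1 / (2Cd)\<close>, so that \<open>G\<close> has variation at most \<open>Var g\<close> over every such stretch of time and at most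
  \<open>(2Cdm + 1) Var g\<close> over the first \<open>m\<close> steps (\<open>bounded_type_badly_approximable\<close>,
  \<open>orbit_variation\<close>).

  As this variation is bounded along a window of \<open>F\<close>, one of sufficiently many equal parts of the
  window carries little of it, and \<open>F + G\<close> is almost a constant \<open>q\<close> on this part
  (\<open>steady_subwindow\<close>). The danger is that \<open>G\<close> cancels \<open>p\<close>, so that \<open>q\<close> is close to \<open>0\<close>. For a
  single window this cannot be excluded: if \<open>C R\<^sub>2\<close> is small, \<open>Var g\<close> may well exceed \<open>\<eta>\<close>.
  But the rotation is an isometry, hence the property of \<open>f\<close> applies again to the pair formed by
  the two orbits at the time of the failure and yields the next window. Each failure costs \<open>G\<close> a
  variation of at least \<open>3\<eta>/4\<close>, whereas a window takes time at most about \<open>2 R\<^sub>2 / d\<close>, in which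
  \<open>G\<close> is entitled on average to \<open>4 C R\<^sub>2 Var g < \<eta>/2\<close> only. The additional \<open>Var g\<close> is used up after
  a number \<open>J\<close> of failures that depends neither on the pair nor on the precision, and one of the first
  \<open>J\<close> windows must succeed (\<open>escaping_window\<close>). So all pairs of close points of the circle are good,
  with values \<open>q\<close> in a compact set bounded away from \<open>0\<close>.
\<close>

section \<open>Rotation numbers of bounded type\<close>

text \<open>Denominators and numerators of the convergents, with the index shifted by one: the sequence begins
  with the formal convergent \<open>1/0\<close>, so that the determinant of consecutive convergents and the ratio
  of consecutive errors follow a single rule from index \<open>0\<close> on.\<close>

fun conv_den :: "real \<Rightarrow> nat \<Rightarrow> int" where
  "conv_den \<alpha> 0 = 0"
| "conv_den \<alpha> (Suc 0) = 1"
| "conv_den \<alpha> (Suc (Suc n)) = partial_quotient \<alpha> (Suc n) * conv_den \<alpha> (Suc n) + conv_den \<alpha> n"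

fun conv_num :: "real \<Rightarrow> nat \<Rightarrow> int" where
  "conv_num \<alpha> 0 = 1"
| "conv_num \<alpha> (Suc 0) = partial_quotient \<alpha> 0"
| "conv_num \<alpha> (Suc (Suc n)) = partial_quotient \<alpha> (Suc n) * conv_num \<alpha> (Suc n) + conv_num \<alpha> n"

definition conv_err :: "real \<Rightarrow> nat \<Rightarrow> real"
  where "conv_err \<alpha> n = of_int (conv_den \<alpha> n) * \<alpha> - of_int (conv_num \<alpha> n)"

lemma frac_irrational:
  assumes "x \<notin> \<rat>"
  shows "frac x \<notin> \<rat>"
proof
  assume "frac x \<in> \<rat>"
  then have "frac x + of_int \<lfloor>x\<rfloor> \<in> \<rat>"
    by (intro Rats_add Rats_of_int)
  with assms show False
    by (simp add: frac_def)
qed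

lemma complete_quotient_irrational:
  assumes "\<alpha> \<notin> \<rat>"
  shows "complete_quotient \<alpha> n \<notin> \<rat>"
proof (induction n)
  case 0
  show ?case using assms by simp
next
  case (Suc n)
  show ?case
  proof
    assume "complete_quotient \<alpha> (Suc n) \<in> \<rat>"
    then have "inverse (1 / frac (complete_quotient \<alpha> n)) \<in> \<rat>"
      by (intro Rats_inverse) simp
    with frac_irrational[OF Suc.IH] show False
      by simp
  qed
qed

lemma frac_complete_quotient_pos:
  assumes "\<alpha> \<notin> \<rat>"
  shows "0 < frac (complete_quotient \<alpha> n)"
proof -
  have "complete_quotient \<alpha> n \<notin> \<int>"
    using complete_quotient_irrational[OF assms] Ints_subset_Rats by blast
  then show ?thesis
    by (simp add: frac_gt_0_iff)
qed

lemma partial_quotient_ge_1: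
  assumes "\<alpha> \<notin> \<rat>"
  shows "1 \<le> partial_quotient \<alpha> (Suc n)"
proof -
  have "1 \<le> complete_quotient \<alpha> (Suc n)"
    using frac_complete_quotient_pos[OF assms, of n] frac_lt_1[of "complete_quotient \<alpha> n"]
    by (simp add: field_simps)
  then show ?thesis
    by (simp add: partial_quotient_def le_floor_iff)
qed

lemma conv_den_mono_step:
  assumes "\<alpha> \<notin> \<rat>"
  shows "0 \<le> conv_den \<alpha> n \<and> conv_den \<alpha> n \<le> conv_den \<alpha> (Suc n) \<and> 1 \<le> conv_den \<alpha> (Suc n)"
proof (induction n)
  case 0
  show ?case by simp
next
  case (Suc n)
  have "1 * conv_den \<alpha> (Suc n) \<le> partial_quotient \<alpha> (Suc n) * conv_den \<alpha> (Suc n)"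
    using Suc.IH partial_quotient_ge_1[OF assms, of n] by (intro mult_right_mono) auto
  then show ?case
    unfolding conv_den.simps using Suc.IH by linarith
qed

lemma conv_den_ge:
  assumes "\<alpha> \<notin> \<rat>"
  shows "int n \<le> conv_den \<alpha> (Suc n)"
proof (induction n)
  case 0
  show ?case by simp
next
  case (Suc n)
  have *: "1 * conv_den \<alpha> (Suc n) \<le> partial_quotient \<alpha> (Suc n) * conv_den \<alpha> (Suc n)"
    using conv_den_mono_step[OF assms, of n] partial_quotient_ge_1[OF assms, of n]
    by (intro mult_right_mono) auto
  show ?case
  proof (cases n)
    case 0
    then show ?thesis using conv_den_mono_step[OF assms, of 1] by simp
  next
    case (Suc k)
    then have "1 \<le> conv_den \<alpha> n"
      using conv_den_mono_step[OF assms, of k] by simp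
    then show ?thesis
      using * Suc.IH by simp
  qed
qed

text \<open>The errors satisfy the recursion of the convergents, and \<open>a\<^sub>n = \<lfloor>1 / t\<rfloor>\<close> is precisely what
  turns the ratio \<open>- t\<close> of consecutive errors into minus the next fractional part. In particular the
  errors alternate in sign and decrease in size.\<close>

lemma conv_err_Suc:
  assumes "\<alpha> \<notin> \<rat>"
  shows "conv_err \<alpha> (Suc n) = - frac (complete_quotient \<alpha> n) * conv_err \<alpha> n"
proof (induction n)
  case 0
  show ?case by (simp add: conv_err_def partial_quotient_def frac_def)
next
  case (Suc n)
  let ?t = "frac (complete_quotient \<alpha> n)"
  have t: "0 < ?t"
    by (rule frac_complete_quotient_pos[OF assms])
  have "conv_err \<alpha> (Suc (Suc n))
      = partial_quotient \<alpha> (Suc n) * conv_err \<alpha> (Suc n) + conv_err \<alpha> n"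
    by (simp add: conv_err_def algebra_simps)
  also have "conv_err \<alpha> n = - (1 / ?t) * conv_err \<alpha> (Suc n)"
    using t Suc.IH by simp
  also have "partial_quotient \<alpha> (Suc n) * conv_err \<alpha> (Suc n) + - (1 / ?t) * conv_err \<alpha> (Suc n)
      = - frac (complete_quotient \<alpha> (Suc n)) * conv_err \<alpha> (Suc n)"
    by (simp add: partial_quotient_def frac_def[of "1 / ?t"] algebra_simps)
  finally show ?case .
qed

lemma conv_det:
  "conv_den \<alpha> (Suc n) * conv_num \<alpha> n - conv_den \<alpha> n * conv_num \<alpha> (Suc n) = (-1) ^ n"
  by (induction n) (simp_all add: algebra_simps)

text \<open>Eliminating \<open>\<alpha>\<close> from two consecutive errors leaves the determinant \<open>\<plusminus>1\<close>; as the errors have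
  opposite signs and decrease, both terms are bounded by the larger error.\<close>

lemma conv_err_lower:
  assumes "\<alpha> \<notin> \<rat>"
  shows "1 \<le> (conv_den \<alpha> (Suc n) + conv_den \<alpha> n) * \<bar>conv_err \<alpha> n\<bar>"
proof -
  let ?q = "\<lambda>n. real_of_int (conv_den \<alpha> n)" and ?e = "conv_err \<alpha>"
  let ?t = "frac (complete_quotient \<alpha> n)"
  have "?q (Suc n) * ?e n - ?q n * ?e (Suc n)
      = - of_int (conv_den \<alpha> (Suc n) * conv_num \<alpha> n - conv_den \<alpha> n * conv_num \<alpha> (Suc n))"
    by (simp add: conv_err_def algebra_simps)
  also have "\<bar>\<dots>\<bar> = 1"
    by (simp add: conv_det)
  finally have "1 = \<bar>(?q (Suc n) + ?q n * ?t) * ?e n\<bar>"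
    by (simp add: conv_err_Suc[OF assms] algebra_simps)
  also have "\<dots> = (?q (Suc n) + ?q n * ?t) * \<bar>?e n\<bar>"
    using conv_den_mono_step[OF assms, of n] frac_ge_0[of "complete_quotient \<alpha> n"]
    by (simp add: abs_mult)
  also have "\<dots> \<le> (?q (Suc n) + ?q n) * \<bar>?e n\<bar>"
    using conv_den_mono_step[OF assms, of n] frac_lt_1[of "complete_quotient \<alpha> n"]
    by (intro mult_right_mono add_left_mono mult_left_le) auto
  finally show ?thesis by simp
qed

text \<open>Two consecutive convergents form a basis of \<open>\<int>\<^sup>2\<close>. If \<open>(j, i)\<close> has coordinates \<open>u, v\<close> in
  this basis and \<open>0 < j < q\<^bsub>n+1\<^esub>\<close>, then \<open>u\<close> and \<open>v\<close> have opposite signs or \<open>v = 0\<close>. Since the errors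
  alternate as well, the two contributions to \<open>j \<alpha> - i\<close> add up without cancellation.\<close>

lemma best_approximation:
  assumes \<alpha>: "\<alpha> \<notin> \<rat>" and j: "0 < j" "j < conv_den \<alpha> (Suc n)"
  shows "\<bar>conv_err \<alpha> n\<bar> \<le> \<bar>of_int j * \<alpha> - of_int i\<bar>"
proof -
  let ?q = "conv_den \<alpha>" and ?p = "conv_num \<alpha>"
  let ?t = "frac (complete_quotient \<alpha> n)"
  (* Cramer's rule *)
  define u where "u = (-1) ^ n * (i * ?q (Suc n) - j * ?p (Suc n))"
  define v where "v = - ((-1) ^ n * (i * ?q n - j * ?p n))"
  have s: "(-1) ^ n * (?q (Suc n) * ?p n - ?q n * ?p (Suc n)) = (1::int)"
    by (simp add: conv_det flip: power_add)
  have "u * ?q n + v * ?q (Suc n) = j * ((-1) ^ n * (?q (Suc n) * ?p n - ?q n * ?p (Suc n)))"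
    by (simp add: u_def v_def algebra_simps)
  then have uj: "u * ?q n + v * ?q (Suc n) = j"
    by (simp only: s mult_1_right)
  have "u * ?p n + v * ?p (Suc n) = i * ((-1) ^ n * (?q (Suc n) * ?p n - ?q n * ?p (Suc n)))"
    by (simp add: u_def v_def algebra_simps)
  then have ui: "u * ?p n + v * ?p (Suc n) = i"
    by (simp only: s mult_1_right)
  have "of_int j * \<alpha> - of_int i = u * conv_err \<alpha> n + v * conv_err \<alpha> (Suc n)"
    by (simp add: conv_err_def algebra_simps flip: uj ui)
  also have "\<dots> = (u - v * ?t) * conv_err \<alpha> n"
    by (simp add: conv_err_Suc[OF \<alpha>] algebra_simps)
  finally have eq: "of_int j * \<alpha> - of_int i = (u - v * ?t) * conv_err \<alpha> n" .
  have q: "0 \<le> ?q n" "1 \<le> ?q (Suc n)"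
    using conv_den_mono_step[OF \<alpha>, of n] by auto
  have t: "0 < ?t"
    by (rule frac_complete_quotient_pos[OF \<alpha>])
  have "1 \<le> \<bar>u - v * ?t\<bar>"
  proof (cases v "0::int" rule: linorder_cases)
    case equal
    then have "u \<noteq> 0" using uj j by auto
    then show ?thesis using equal by simp
  next
    case greater
    then have "1 * ?q (Suc n) \<le> v * ?q (Suc n)"
      using q by (intro mult_right_mono) auto
    then have "u * ?q n < 0" using uj j by linarith
    then have "u < 0" using q by (simp add: mult_less_0_iff)
    then have "real_of_int u \<le> -1" by linarith
    moreover have "0 \<le> v * ?t" using greater t by simp
    ultimately show ?thesis by linarith
  next
    case less
    then have "v * ?q (Suc n) \<le> 0"
      using q by (simp add: mult_le_0_iff)
    then have "0 < u * ?q n" using uj j by linarith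
    then have "0 < u" using q by (simp add: zero_less_mult_iff)
    then have "1 \<le> real_of_int u" by linarith
    moreover have "v * ?t \<le> 0" using less t by (simp add: mult_le_0_iff)
    ultimately show ?thesis by linarith
  qed
  then have "1 * \<bar>conv_err \<alpha> n\<bar> \<le> \<bar>u - v * ?t\<bar> * \<bar>conv_err \<alpha> n\<bar>"
    by (intro mult_right_mono) auto
  then show ?thesis
    by (simp add: eq abs_mult)
qed

text \<open>If \<open>q\<^sub>k \<le> j < q\<^bsub>k+1\<^esub>\<close>, then \<open>j \<alpha>\<close> is no closer to an integer than \<open>q\<^sub>k \<alpha>\<close>, and bounded
  quotients keep \<open>q\<^bsub>k+1\<^esub>\<close> comparable with \<open>q\<^sub>k\<close>, hence with \<open>j\<close>.\<close>

lemma bounded_type_badly_approximable: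
  fixes A :: real
  assumes \<alpha>: "\<alpha> \<notin> \<rat>" and A: "\<And>n. partial_quotient \<alpha> (Suc n) \<le> A" and j: "1 \<le> j"
  shows "1 \<le> (A + 2) * real j * nearest_int_dist (real j * \<alpha>)"
proof -
  define n' where "n' = (LEAST n. int j < conv_den \<alpha> n)"
  have "int j < conv_den \<alpha> (Suc (Suc j))"
    using conv_den_ge[OF \<alpha>, of "Suc j"] by simp
  then have n': "int j < conv_den \<alpha> n'"
    unfolding n'_def by (rule LeastI)
  have "n' \<noteq> 0" "n' \<noteq> Suc 0"
    using n' j by (auto intro: ccontr)
  then obtain k where k: "n' = Suc (Suc k)"
    by (metis not0_implies_Suc)
  let ?q = "conv_den \<alpha>"
  have qj: "?q (Suc k) \<le> int j"
    using not_less_Least[of "Suc k" "\<lambda>n. int j < conv_den \<alpha> n"] k by (simp add: n'_def)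
  have q: "?q k \<le> ?q (Suc k)" "1 \<le> ?q (Suc k)"
    using conv_den_mono_step[OF \<alpha>, of k] by auto
  have A1: "1 \<le> A"
    using A[of 0] partial_quotient_ge_1[OF \<alpha>, of 0] by linarith
  have "?q (Suc (Suc k)) + ?q (Suc k)
      \<le> real_of_int (partial_quotient \<alpha> (Suc k)) * ?q (Suc k) + 2 * ?q (Suc k)"
    using q by simp
  also have "\<dots> \<le> A * ?q (Suc k) + 2 * ?q (Suc k)"
    using q A[of k] by (intro add_right_mono mult_right_mono) auto
  also have "\<dots> = (A + 2) * ?q (Suc k)"
    by (simp add: algebra_simps)
  also have "\<dots> \<le> (A + 2) * real j"
    using qj A1 by (intro mult_left_mono) auto
  finally have le: "?q (Suc (Suc k)) + ?q (Suc k) \<le> (A + 2) * real j" .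
  have "1 \<le> (?q (Suc (Suc k)) + ?q (Suc k)) * \<bar>conv_err \<alpha> (Suc k)\<bar>"
    using conv_err_lower[OF \<alpha>, of "Suc k"] by simp
  also have "\<dots> \<le> (A + 2) * real j * \<bar>conv_err \<alpha> (Suc k)\<bar>"
    using le by (intro mult_right_mono) auto
  also have "\<dots> \<le> (A + 2) * real j * \<bar>real j * \<alpha> - of_int (round (real j * \<alpha>))\<bar>"
    using best_approximation[OF \<alpha>, of "int j" "Suc k" "round (real j * \<alpha>)"] n' j A1
    by (intro mult_left_mono) (auto simp: k simp del: conv_den.simps)
  finally show ?thesis
    by (simp add: nearest_int_dist_def)
qed


section \<open>Variation along an orbit\<close>

lemma sum_increments_le_variation:
  assumes "circle_variation g = ereal V" "mono_on {..n} t" "t n = t 0 + 1"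
  shows "(\<Sum>k<n. \<bar>g (to_circle (t (Suc k))) - g (to_circle (t k))\<bar>) \<le> V"
proof -
  have "ereal (\<Sum>k<n. \<bar>g (to_circle (t (Suc k))) - g (to_circle (t k))\<bar>) \<le> circle_variation g"
    unfolding circle_variation_def using assms(2,3) by (intro SUP_upper2[of "(n, t)"]) auto
  then show ?thesis using assms(1) by simp
qed

lemma to_circle_add: "to_circle (s + t) = to_circle s + to_circle t"
  by (rule plus_circle.abs_eq[symmetric])

lemma to_circle_frac_rep: "to_circle (frac (rep_circle x)) = x"
proof -
  have "to_circle (frac (rep_circle x)) = to_circle (rep_circle x)"
    by (simp add: circle.abs_eq_iff frac_def)
  then show ?thesis
    by (simp add: Quotient3_abs_rep[OF Quotient3_circle])
qed

text \<open>Non-overlapping arcs \<open>[x, x + d]\<close> are every second piece of one cyclic partition, whose points are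
  the end points of the arcs in cyclic order.\<close>

lemma sum_disjoint_arcs_le_variation:
  assumes V: "circle_variation g = ereal V" and d: "0 < d" "d \<le> 1" and fin: "finite A"
    and sep: "\<And>x y. x \<in> A \<Longrightarrow> y \<in> A \<Longrightarrow> x \<noteq> y \<Longrightarrow> d \<le> dist x y"
  shows "(\<Sum>x\<in>A. \<bar>g (x + to_circle d) - g x\<bar>) \<le> V"
proof -
  define lift where "lift x = frac (rep_circle x)" for x
  define B where "B = lift ` A"
  define \<phi> where "\<phi> b = \<bar>g (to_circle (b + d)) - g (to_circle b)\<bar>" for b
  have tl: "to_circle (lift x) = x" for x
    by (simp add: lift_def to_circle_frac_rep)
  have inj: "inj_on lift A"
    by (metis inj_onI tl)
  have finB: "finite B" using fin by (simp add: B_def)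
  have "(\<Sum>x\<in>A. \<bar>g (x + to_circle d) - g x\<bar>) = sum \<phi> B"
    unfolding B_def using inj by (simp add: sum.reindex \<phi>_def to_circle_add tl)
  have gap: "d \<le> b - a \<and> b + d \<le> a + 1" if "a \<in> B" "b \<in> B" "a < b" for a b
  proof -
    have ab: "0 \<le> a" "b < 1"
      using that by (auto simp: B_def lift_def frac_lt_1)
    have "to_circle a \<in> A" "to_circle b \<in> A" "to_circle a \<noteq> to_circle b"
      using that by (auto simp: B_def tl)
    then have "d \<le> nearest_int_dist (b - a)"
      using sep[of "to_circle b" "to_circle a"] by (auto simp: dist_to_circle)
    then show ?thesis
      using nearest_int_dist_le[of "b - a" 0] nearest_int_dist_le[of "b - a" 1] that ab by auto
  qed
  define ts where "ts = sorted_list_of_set B"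
  define n where "n = length ts"
  have ts: "distinct ts" "set ts = B" "sorted_wrt (<) ts"
    using finB by (auto simp: ts_def)
  have ts_less: "ts ! i < ts ! j" if "i < j" "j < n" for i j
    using ts(3) that by (auto simp: sorted_wrt_iff_nth_less n_def)
  have ts_in: "ts ! i \<in> B" if "i < n" for i
    using that ts(2) nth_mem n_def by blast
  have sumB: "sum \<phi> B = (\<Sum>i<n. \<phi> (ts ! i))"
    using sum.reindex_bij_betw[OF bij_betw_nth[OF ts(1) _ ts(2)[symmetric]], of "{..<n}" \<phi>]
    by (simp add: n_def)
  (* Constant beyond the closing index, so that the partition is monotone on all of nat. *)
  define t where
    "t k = (if k < 2 * n then ts ! (k div 2) + (if odd k then d else 0) else ts ! 0 + 1)" for k
  have "incseq t"
  proof (rule incseq_SucI)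
    fix k
    (* an arc, a gap between arcs, the gap across the closing point, and the constant tail *)
    consider "Suc k < 2 * n" "even k" | i where "k = 2 * i + 1" "Suc i < n"
      | "n \<noteq> 0" "k = 2 * (n - 1) + 1" | "2 * n \<le> k"
    proof -
      assume c1: "Suc k < 2 * n \<Longrightarrow> even k \<Longrightarrow> thesis"
        and c2: "\<And>i. k = 2 * i + 1 \<Longrightarrow> Suc i < n \<Longrightarrow> thesis"
        and c3: "n \<noteq> 0 \<Longrightarrow> k = 2 * (n - 1) + 1 \<Longrightarrow> thesis" and c4: "2 * n \<le> k \<Longrightarrow> thesis"
      show thesis
      proof (cases "even k")
        case True
        then show thesis using c1 c4 by (metis Suc_lessI dvd_triv_left even_Suc not_le)
      next
        case False
        then obtain i where "k = 2 * i + 1" by (auto elim: oddE)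
        then show thesis using c2[of i] c3 c4 by (cases "Suc i < n"; cases "Suc i = n") auto
      qed
    qed
    then show "t k \<le> t (Suc k)"
    proof cases
      case 1
      then show ?thesis using d by (auto simp: t_def)
    next
      case (2 i)
      then have "t k = ts ! i + d" "t (Suc k) = ts ! Suc i"
        by (auto simp: t_def)
      moreover have "d \<le> ts ! Suc i - ts ! i"
        using gap[of "ts ! i" "ts ! Suc i"] ts_in ts_less 2 by auto
      ultimately show ?thesis by simp
    next
      case 3
      then have eq: "t k = ts ! (n - 1) + d" "t (Suc k) = ts ! 0 + 1"
        by (auto simp: t_def)
      show ?thesis
      proof (cases "n = 1")
        case True
        then show ?thesis using eq d by simp
      next
        case False
        then show ?thesis
          using gap[of "ts ! 0" "ts ! (n - 1)"] ts_in ts_less 3 eq by auto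
      qed
    next
      case 4
      then show ?thesis by (simp add: t_def)
    qed
  qed
  then have mono: "mono_on {..2 * n} t"
    by (auto simp: mono_on_def monoD)
  have nonneg: "0 \<le> V"
    using sum_increments_le_variation[OF V, of 1 real] by (force simp: mono_on_def)
  show ?thesis
  proof (cases "n = 0")
    case True
    then show ?thesis
      using nonneg sumB \<open>(\<Sum>x\<in>A. \<bar>g (x + to_circle d) - g x\<bar>) = sum \<phi> B\<close> by simp
  next
    case False
    let ?\<psi> = "\<lambda>k. \<bar>g (to_circle (t (Suc k))) - g (to_circle (t k))\<bar>"
    have "(\<Sum>i<n. \<phi> (ts ! i)) = (\<Sum>i<n. ?\<psi> (2 * i))"
      by (intro sum.cong) (auto simp: t_def \<phi>_def)
    also have "\<dots> = sum ?\<psi> ((*) 2 ` {..<n})"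
      by (simp add: sum.reindex inj_on_def)
    also have "\<dots> \<le> (\<Sum>k<2 * n. ?\<psi> k)"
      by (intro sum_mono2) auto
    also have "\<dots> \<le> V"
      using False by (intro sum_increments_le_variation[OF V mono]) (simp add: t_def)
    finally show ?thesis
      using sumB \<open>(\<Sum>x\<in>A. \<bar>g (x + to_circle d) - g x\<bar>) = sum \<phi> B\<close> by simp
  qed
qed

lemma rotation_funpow: "(rotation \<alpha> ^^ k) x = x + to_circle (real k * \<alpha>)"
proof (induction k)
  case 0
  have "to_circle 0 = 0" by (simp add: zero_circle_def)
  then show ?case by simp
next
  case (Suc k)
  then show ?case
    by (simp add: rotation_def algebra_simps to_circle_add)
qed

lemma dist_circle_translate: "dist (x + z) (y + z) = dist x (y :: circle)"
  by transfer (simp only: add_diff_cancel_right)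

lemma dist_circle_translate_left: "dist (z + x) (z + y) = dist x (y :: circle)"
  using dist_circle_translate[of x z y] by (simp add: add.commute)

lemma dist_rotation_funpow: "dist ((rotation \<alpha> ^^ k) x) ((rotation \<alpha> ^^ k) y) = dist x y"
  by (simp add: rotation_funpow dist_circle_translate)

lemma translate_by_dist:
  "y = x + to_circle (dist x y) \<or> x = y + to_circle (dist x y)"
proof -
  define s t where "s = rep_circle x" and "t = rep_circle y"
  have st: "x = to_circle s" "y = to_circle t"
    by (simp_all add: s_def t_def Quotient3_abs_rep[OF Quotient3_circle])
  have "dist x y = \<bar>s - t - of_int (round (s - t))\<bar>"
    by (simp add: st dist_to_circle nearest_int_dist_def)
  then have "s - (t + dist x y) \<in> \<int> \<or> t - (s + dist x y) \<in> \<int>"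
    by (auto simp: abs_if algebra_simps)
  then show ?thesis
    by (metis st to_circle_add circle.abs_eq_iff)
qed

text \<open>For at most \<open>1 / (Q d)\<close> further steps the orbit does not come closer than \<open>d\<close> to itself, so
  the translates of the arc from \<open>x\<close> to \<open>x + d\<close> do not overlap.\<close>

lemma block_variation:
  assumes V: "circle_variation g = ereal V" and Q: "0 < Q"
    and ba: "\<And>j. 1 \<le> j \<Longrightarrow> 1 \<le> Q * real j * nearest_int_dist (real j * \<alpha>)"
    and d: "0 < d" "d \<le> 1" "Q * d * real b \<le> 1"
  shows "(\<Sum>k=k0..<k0 + Suc b. \<bar>g ((rotation \<alpha> ^^ k) (x + to_circle d))
             - g ((rotation \<alpha> ^^ k) x)\<bar>) \<le> V"
proof -
  let ?T = "\<lambda>k. (rotation \<alpha> ^^ k) x" and ?I = "{k0..<k0 + Suc b}"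
  have sep': "d \<le> dist (?T k) (?T l)" if "k \<in> ?I" "l \<in> ?I" "l < k" for k l
  proof -
    define j where "j = k - l"
    have j: "1 \<le> j" "j \<le> b" using that by (auto simp: j_def)
    have "dist (?T k) (?T l) = nearest_int_dist (real j * \<alpha>)"
      using that by (simp add: rotation_funpow dist_circle_translate_left dist_to_circle j_def
          of_nat_diff algebra_simps)
    moreover have "d \<le> nearest_int_dist (real j * \<alpha>)"
    proof (rule ccontr)
      assume "\<not> ?thesis"
      then have "Q * real j * nearest_int_dist (real j * \<alpha>) < Q * real j * d"
        using Q j by (intro mult_strict_left_mono) auto
      also have "\<dots> \<le> Q * real b * d"
        using Q j d by (intro mult_right_mono mult_left_mono) auto
      finally show False
        using ba[OF j(1)] d(3) by (simp add: algebra_simps)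
    qed
    ultimately show ?thesis by simp
  qed
  have sep: "d \<le> dist (?T k) (?T l)" if "k \<in> ?I" "l \<in> ?I" "k \<noteq> l" for k l
    using sep'[of k l] sep'[of l k] that by (cases "k < l") (auto simp: dist_commute)
  have inj: "inj_on ?T ?I"
  proof (rule inj_onI, rule ccontr)
    fix k l assume "k \<in> ?I" "l \<in> ?I" "?T k = ?T l" "k \<noteq> l"
    with sep[of k l] d show False by auto
  qed
  have "(\<Sum>k\<in>?I. \<bar>g ((rotation \<alpha> ^^ k) (x + to_circle d)) - g (?T k)\<bar>)
      = (\<Sum>y\<in>?T ` ?I. \<bar>g (y + to_circle d) - g y\<bar>)"
    unfolding sum.reindex[OF inj] by (simp add: rotation_funpow algebra_simps)
  also have "\<dots> \<le> V"
    by (rule sum_disjoint_arcs_le_variation[OF V d(1,2)]) (auto intro!: sep)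
  finally show ?thesis .
qed

text \<open>The orbit is cut into blocks of non-overlapping arcs. A full block has length at least \<open>1 / (Q d)\<close>;
  the \<open>+ 1\<close> accounts for the incomplete block.\<close>

lemma orbit_variation:
  assumes V: "circle_variation g = ereal V" and Q: "0 < Q"
    and ba: "\<And>j. 1 \<le> j \<Longrightarrow> 1 \<le> Q * real j * nearest_int_dist (real j * \<alpha>)"
    and d: "dist x x' = d" "0 < d"
  shows "(\<Sum>k<m. \<bar>g ((rotation \<alpha> ^^ k) x) - g ((rotation \<alpha> ^^ k) x')\<bar>) \<le> (Q * d * real m + 1) * V"
proof -
  let ?\<phi> = "\<lambda>k. \<bar>g ((rotation \<alpha> ^^ k) x) - g ((rotation \<alpha> ^^ k) x')\<bar>"
  have "d \<le> 1"
    using d(1) of_int_round_abs_le[of "rep_circle x - rep_circle x'"]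
    by (simp add: dist_circle.rep_eq nearest_int_dist_def abs_minus_commute)
  define b where "b = nat \<lfloor>1 / (Q * d)\<rfloor>"
  have "real b \<le> 1 / (Q * d)" "1 / (Q * d) < real b + 1"
    using Q d by (auto simp: b_def)
  then have b: "Q * d * real b \<le> 1" "1 \<le> Q * d * (real b + 1)"
    using Q d by (simp_all add: field_simps)
  have block: "sum ?\<phi> {k0..<k0 + Suc b} \<le> V" for k0
  proof -
    consider "x = x' + to_circle d" | "x' = x + to_circle d"
      using translate_by_dist[of x' x] d by (metis dist_commute)
    then show ?thesis
    proof cases
      case 1
      then show ?thesis
        using block_variation[OF V Q ba d(2) \<open>d \<le> 1\<close> b(1), of x' k0] by simp
    next
      case 2
      then show ?thesis
        using block_variation[OF V Q ba d(2) \<open>d \<le> 1\<close> b(1), of x k0]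
        by (simp add: abs_minus_commute)
    qed
  qed
  have V0: "0 \<le> V"
    using block[of 0] sum_nonneg[of "{0..<0 + Suc b}" ?\<phi>] by linarith
  show ?thesis
  proof (induction m rule: less_induct)
    case (less m)
    show ?case
    proof (cases "m \<le> Suc b")
      case True
      then have "sum ?\<phi> {..<m} \<le> sum ?\<phi> {0..<0 + Suc b}"
        by (intro sum_mono2) auto
      also have "\<dots> \<le> V" by (rule block)
      also have "1 * V \<le> (Q * d * real m + 1) * V"
        using Q d V0 by (intro mult_right_mono) auto
      finally show ?thesis by simp
    next
      case False
      define m' where "m' = m - Suc b"
      have m: "m = m' + Suc b" using False by (simp add: m'_def)
      have "sum ?\<phi> {..<m} = sum ?\<phi> {..<m'} + sum ?\<phi> {m'..<m' + Suc b}"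
        using sum.atLeastLessThan_concat[of 0 m' m ?\<phi>] by (simp only: m atLeast0LessThan)
      also have "\<dots> \<le> (Q * d * real m' + 1) * V + 1 * V"
        using less.IH[of m'] block[of m'] m by simp
      also have "\<dots> \<le> (Q * d * real m' + 1) * V + Q * d * (real b + 1) * V"
        using b(2) V0 by (intro add_left_mono mult_right_mono) auto
      also have "\<dots> = (Q * d * real m + 1) * V"
        by (simp add: m algebra_simps)
      finally show ?thesis .
    qed
  qed
qed

section \<open>Iterating the windows\<close>

text \<open>Pigeonhole: of \<open>K\<close> consecutive parts of the window starting at \<open>m + M\<close>, one carries at most the
  fraction \<open>1 / K\<close> of the variation of \<open>G\<close>. The window is first cut down to length at most \<open>M\<close>, which
  keeps the elapsed time proportional to \<open>M\<close>; the lower bound \<open>N * K\<close> makes the rounding in \<open>div\<close>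
  cost at most a factor \<open>2\<close>.\<close>

lemma steady_subwindow:
  fixes G :: "nat \<Rightarrow> real"
  assumes N: "1 \<le> N" "N * K \<le> M" "N * K \<le> L" and K: "0 < K" and \<kappa>: "\<kappa> \<le> 1" "\<kappa> * real M \<le> real L"
    and W: "(\<Sum>k<m + 2 * M. \<bar>G (Suc k) - G k\<bar>) \<le> W" "W \<le> real K * \<epsilon>"
  shows "\<exists>a l. m + M \<le> a \<and> a + l \<le> m + M + L \<and> a + l \<le> m + 2 * M \<and> N \<le> l \<and>
           \<kappa> * real M \<le> 2 * real K * real l \<and> (\<forall>n\<in>{a..a + l}. \<bar>G n - G a\<bar> \<le> \<epsilon>)"
proof -
  define \<Delta> where "\<Delta> k = \<bar>G (Suc k) - G k\<bar>" for k
  define l where "l = min L M div K"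
  have Kl: "K * l \<le> L" "K * l \<le> M"
    using div_times_less_eq_dividend[of "min L M" K] by (auto simp: l_def mult.commute)
  have Nl: "N \<le> l"
    using N K by (simp add: l_def less_eq_div_iff_mult_less_eq)
  have "\<kappa> * real M \<le> 1 * real M"
    using \<kappa> by (intro mult_right_mono) auto
  then have "\<kappa> * real M \<le> real (min L M)"
    using \<kappa> by auto
  also have "real (min L M) \<le> 2 * real K * real l"
  proof -
    have "min L M \<le> K * l + K"
      using K mult_div_mod_eq[of K "min L M"] mod_less_divisor[of K "min L M"]
      unfolding l_def by linarith
    also have "K * l + K \<le> 2 * (K * l)"
      using Nl N by simp
    finally have "real (min L M) \<le> real (2 * (K * l))"
      by (rule of_nat_mono)
    then show ?thesis by simp
  qed
  finally have \<kappa>l: "\<kappa> * real M \<le> 2 * real K * real l" .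
  have "sum \<Delta> ((+) (m + M) ` {..<K * l}) \<le> sum \<Delta> {..<m + 2 * M}"
    using Kl by (intro sum_mono2) (auto simp: \<Delta>_def)
  then have "(\<Sum>k<K * l. \<Delta> (m + M + k)) \<le> real K * \<epsilon>"
    using W by (simp add: sum.reindex \<Delta>_def)
  then have le: "(\<Sum>i<K. \<Sum>k=i * l..<i * l + l. \<Delta> (m + M + k)) \<le> real K * \<epsilon>"
    by (simp only: sum.nat_group)
  obtain i where i: "i < K" "(\<Sum>k=i * l..<i * l + l. \<Delta> (m + M + k)) \<le> \<epsilon>"
  proof (rule ccontr)
    assume "\<not> thesis"
    then have "\<epsilon> < (\<Sum>k=i * l..<i * l + l. \<Delta> (m + M + k))" if "i < K" for i
      using that \<open>\<And>i. \<lbrakk>i < K; _ i\<rbrakk> \<Longrightarrow> thesis\<close> by (meson not_le)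
    then have "(\<Sum>i<K. \<epsilon>) < (\<Sum>i<K. \<Sum>k=i * l..<i * l + l. \<Delta> (m + M + k))"
      using K by (intro sum_strict_mono) auto
    with le show False by simp
  qed
  define a where "a = m + M + i * l"
  have "\<bar>G n - G a\<bar> \<le> \<epsilon>" if "n \<in> {a..a + l}" for n
  proof -
    have "\<bar>G n - G a\<bar> = \<bar>\<Sum>k=a..<n. G (Suc k) - G k\<bar>"
      using that by (subst sum_Suc_diff') auto
    also have "\<dots> \<le> sum \<Delta> {a..<n}"
      unfolding \<Delta>_def by (rule sum_abs)
    also have "\<dots> \<le> sum \<Delta> {a..<a + l}"
      using that by (intro sum_mono2) (auto simp: \<Delta>_def)
    also have "\<dots> = (\<Sum>k=i * l..<i * l + l. \<Delta> (m + M + k))"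
      using sum.shift_bounds_nat_ivl[of \<Delta> "i * l" "m + M" "i * l + l"]
      by (simp add: a_def algebra_simps)
    finally show ?thesis using i by simp
  qed
  moreover have "i * l + l \<le> K * l"
    using i(1) by (metis Suc_leI add.commute mult_Suc mult_le_mono1)
  ultimately show ?thesis
    using Kl Nl \<kappa>l by (intro exI[of _ a] exI[of _ l]) (auto simp: a_def)
qed

text \<open>If every window fails, \<open>F + G\<close> returns close to \<open>0\<close> after each of them while \<open>F\<close> changes by about
  \<open>p\<close>, so \<open>G\<close> has to compensate: after \<open>J\<close> windows its variation is at least \<open>3 J \<eta> / 4\<close>. By
  \<open>var\<close> it is at most \<open>2 J Q R\<^sub>2 V + V \<le> J \<eta> / 2 + V\<close>, which is less for \<open>J > 4 V / \<eta>\<close>. The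
  bound on the ratio \<open>l / a\<close> is free of \<open>d\<close>, because both \<open>a\<close> and the length of each window are
  comparable with \<open>1 / d\<close>.\<close>

lemma escaping_window:
  fixes F G :: "nat \<Rightarrow> real"
  assumes \<eta>: "0 < \<eta>" and V: "0 \<le> V" and Q: "0 < Q" and R: "0 < R\<^sub>1" "0 < R\<^sub>2" and d: "0 < d"
    and small: "4 * Q * R\<^sub>2 * V \<le> \<eta>" and J: "4 * V < real J * \<eta>"
    and W: "W = (Q * (2 * (real J + 1) * R\<^sub>2) + 1) * V" "W \<le> real K * \<epsilon>"
    and \<epsilon>: "0 < \<epsilon>" "\<epsilon> \<le> \<eta> / 32" and K: "0 < K" and N: "1 \<le> N" and \<kappa>: "0 < \<kappa>" "\<kappa> \<le> 1"
    and zero: "F 0 = 0" "G 0 = 0"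
    and var: "\<And>m. (\<Sum>k<m. \<bar>G (Suc k) - G k\<bar>) \<le> (Q * d * real m + 1) * V"
    and window: "\<And>m. \<exists>M\<ge>N * K. \<exists>L\<ge>N * K. \<exists>p. \<eta> \<le> \<bar>p\<bar> \<and> \<bar>p\<bar> \<le> B \<and> \<kappa> * real M \<le> real L \<and>
                     R\<^sub>1 \<le> real M * d \<and> real M * d \<le> R\<^sub>2 \<and>
                     (\<forall>n\<in>{M..M + L}. \<bar>F (m + n) - F m - p\<bar> < \<epsilon>)"
  shows "\<exists>a\<ge>N. \<exists>l\<ge>N. \<exists>q. \<eta> / 16 \<le> \<bar>q\<bar> \<and> \<bar>q\<bar> \<le> B + \<eta> + W \<and>
           \<kappa> * R\<^sub>1 / (4 * real K * (real J + 1) * R\<^sub>2) * real a \<le> real l \<and>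
           (\<forall>n\<in>{a..a + l}. \<bar>F n + G n - q\<bar> < 2 * \<epsilon>)" (is ?escape)
proof (rule ccontr)
  assume stuck: "\<not> ?escape"
  define S where "S m = (\<Sum>k<m. \<bar>G (Suc k) - G k\<bar>)" for m
  have S_diff: "\<bar>G n - G m\<bar> \<le> S n - S m" if "m \<le> n" for m n
  proof -
    have "\<bar>G n - G m\<bar> = \<bar>\<Sum>k=m..<n. G (Suc k) - G k\<bar>"
      using that by (subst sum_Suc_diff') auto
    also have "\<dots> \<le> (\<Sum>k=m..<n. \<bar>G (Suc k) - G k\<bar>)"
      by (rule sum_abs)
    also have "\<dots> = S n - S m"
      unfolding S_def using that sum_diff_nat_ivl[of 0 m n "\<lambda>k. \<bar>G (Suc k) - G k\<bar>"]
      by (simp add: atLeast0LessThan)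
    finally show ?thesis .
  qed
  have S0: "0 \<le> S m" for m
    by (simp add: S_def sum_nonneg)
  (* State after j failures: the time m reached, the nearly cancelled sum, the variation spent by G.
     The bound eta / 8 leaves room for a failure |q| < eta / 16 and the error 2 * epsilon. *)
  have advance: "\<exists>m. real m * d \<le> 2 * real j * R\<^sub>2 \<and> \<bar>F m + G m\<bar> \<le> \<eta> / 8 \<and> real j * (3 / 4 * \<eta>) \<le> S m"
    if "j \<le> J" for j
    using that
  proof (induction j)
    case 0
    then show ?case using \<eta> zero by (intro exI[of _ 0]) (auto simp: S_def)
  next
    case (Suc j)
    then obtain m where m: "real m * d \<le> 2 * real j * R\<^sub>2" "\<bar>F m + G m\<bar> \<le> \<eta> / 8"
        "real j * (3 / 4 * \<eta>) \<le> S m"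
      by auto
    obtain M L p where M: "N * K \<le> M" "N * K \<le> L" and p: "\<eta> \<le> \<bar>p\<bar>" "\<bar>p\<bar> \<le> B"
      and L: "\<kappa> * real M \<le> real L" and Md: "R\<^sub>1 \<le> real M * d" "real M * d \<le> R\<^sub>2"
      and F: "\<forall>n\<in>{M..M + L}. \<bar>F (m + n) - F m - p\<bar> < \<epsilon>"
      using window[of m] by blast
    have end_le: "real (m + 2 * M) * d \<le> 2 * real (Suc j) * R\<^sub>2"
      using m Md by (simp add: algebra_simps)
    also have "\<dots> \<le> 2 * (real J + 1) * R\<^sub>2"
      using Suc.prems R by (intro mult_right_mono) auto
    finally have end_le': "real (m + 2 * M) * d \<le> 2 * (real J + 1) * R\<^sub>2" .
    have "S (m + 2 * M) \<le> (Q * (real (m + 2 * M) * d) + 1) * V"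
      using var[of "m + 2 * M"] by (simp add: S_def algebra_simps)
    also have "\<dots> \<le> W"
      unfolding W(1) using end_le' Q V by (intro mult_right_mono add_right_mono mult_left_mono) auto
    finally have SW: "S (m + 2 * M) \<le> W" .
    obtain a l where a: "m + M \<le> a" "a + l \<le> m + M + L" "a + l \<le> m + 2 * M" and l: "N \<le> l"
        "\<kappa> * real M \<le> 2 * real K * real l" and G: "\<And>n. n \<in> {a..a + l} \<Longrightarrow> \<bar>G n - G a\<bar> \<le> \<epsilon>"
      using steady_subwindow[OF N M K \<kappa>(2) L SW[unfolded S_def] W(2)] by blast
    have F': "\<bar>F n - F m - p\<bar> < \<epsilon>" if "n \<in> {a..a + l}" for n
    proof -
      have "n - m \<in> {M..M + L}" "m + (n - m) = n" using that a by auto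
      then show ?thesis using F by metis
    qed
    have ad: "real a * d \<le> real (m + 2 * M) * d"
      using a d by (intro mult_right_mono) auto
    define q where "q = F m + p + G a"
    have near: "\<bar>F n + G n - q\<bar> < 2 * \<epsilon>" if "n \<in> {a..a + l}" for n
      using F'[OF that] G[OF that] unfolding q_def by linarith
    have Ga: "\<bar>G a - G m\<bar> \<le> S a - S m"
      using S_diff[of m a] a by simp
    have "S a \<le> W"
      using S_diff[of a "m + 2 * M"] SW a by linarith
    then have qB: "\<bar>q\<bar> \<le> B + \<eta> + W"
      using Ga m(2) p S0[of m] \<eta> unfolding q_def by linarith
    have "\<kappa> * R\<^sub>1 * (real a * d) \<le> \<kappa> * R\<^sub>1 * (2 * (real J + 1) * R\<^sub>2)"
      using ad end_le' \<kappa> R by (intro mult_left_mono) auto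
    also have "\<dots> \<le> \<kappa> * (real M * d) * (2 * (real J + 1) * R\<^sub>2)"
      using Md \<kappa> R by (intro mult_right_mono mult_left_mono) auto
    also have "\<dots> = \<kappa> * real M * (d * (2 * (real J + 1) * R\<^sub>2))"
      by simp
    also have "\<dots> \<le> 2 * real K * real l * (d * (2 * (real J + 1) * R\<^sub>2))"
      using l d R by (intro mult_right_mono) auto
    finally have "(\<kappa> * R\<^sub>1 * real a) * d \<le> (4 * real K * (real J + 1) * R\<^sub>2 * real l) * d"
      by (simp add: algebra_simps)
    then have "\<kappa> * R\<^sub>1 * real a \<le> 4 * real K * (real J + 1) * R\<^sub>2 * real l"
      using d by simp
    then have ratio: "\<kappa> * R\<^sub>1 / (4 * real K * (real J + 1) * R\<^sub>2) * real a \<le> real l"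
      using K R by (simp add: pos_divide_le_eq mult.commute mult.left_commute)
    have "N * 1 \<le> N * K" using K by (intro mult_le_mono2) auto
    then have "N \<le> a" using M a by linarith
    then have q: "\<bar>q\<bar> < \<eta> / 16"
      using stuck l(1) near qB ratio by (meson not_le)
    have "\<bar>F a + G a\<bar> \<le> \<eta> / 8"
    proof -
      have "\<bar>F a + G a - q\<bar> < 2 * \<epsilon>" by (rule near) simp
      then show ?thesis using q \<epsilon> by linarith
    qed
    moreover have "3 / 4 * \<eta> \<le> \<bar>G a - G m\<bar>"
      using q p m(2) unfolding q_def by linarith
    then have "real (Suc j) * (3 / 4 * \<eta>) \<le> S a"
      using Ga m(3) by (simp add: algebra_simps)
    ultimately show ?case
      using ad end_le by (intro exI[of _ a]) auto
  qed
  obtain m where m: "real m * d \<le> 2 * real J * R\<^sub>2" "real J * (3 / 4 * \<eta>) \<le> S m"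
    using advance[of J] by auto
  have "S m \<le> (Q * (real m * d) + 1) * V"
    using var[of m] by (simp add: S_def algebra_simps)
  also have "\<dots> \<le> (Q * (2 * real J * R\<^sub>2) + 1) * V"
    using m Q V by (intro mult_right_mono add_right_mono mult_left_mono) auto
  also have "\<dots> = real J / 2 * (4 * Q * R\<^sub>2 * V) + V"
    by (simp add: algebra_simps)
  also have "\<dots> \<le> real J / 2 * \<eta> + V"
    using small by (intro add_right_mono mult_left_mono) auto
  finally show False
    using m(2) J by (simp add: algebra_simps)
qed

section \<open>Perturbing the roof\<close>

lemma birkhoff_sum_add:
  "birkhoff_sum T h (m + n) x = birkhoff_sum T h m x + birkhoff_sum T h n ((T ^^ m) x)"
proof -
  have "(\<Sum>k<m + n. h ((T ^^ k) x)) = (\<Sum>k<m. h ((T ^^ k) x)) + (\<Sum>k<n. h ((T ^^ (k + m)) x))"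
    by (induction n) (simp_all add: algebra_simps)
  then show ?thesis
    by (simp add: birkhoff_sum_def funpow_add)
qed

theorem theorem5p3:
  fixes \<alpha> C \<eta> c R\<^sub>1 R\<^sub>2 :: real
    and P :: "real set"
    and f g :: "circle \<Rightarrow> real"
  assumes irrational: "\<alpha> \<notin> \<rat>"
    and bounded_quotients: "bdd_above (partial_quotient \<alpha> ` {1..})"
    and C: "C = (SUP n\<in>{1..}. real_of_int (partial_quotient \<alpha> n)) + 1"
    and P: "compact P" "P \<noteq> {}" "0 \<notin> P"
    and \<eta>: "0 < \<eta>" "\<eta> < 1 / 2" "P \<subseteq> - {- \<eta><..<\<eta>}"
    and f_measurable: "f \<in> borel_measurable (completion circle_lborel)"
    and f_ess_bounded: "\<exists>B. AE x in completion circle_lborel. \<bar>f x\<bar> \<le> B"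
    and f_roof: "0 < c" "\<And>x. c \<le> f x"
    and R: "0 < R\<^sub>1" "0 < R\<^sub>2"
    and f_ratner: "strong_cocycle_ratner (rotation \<alpha>) f P R\<^sub>1 R\<^sub>2"
    and g_bv: "circle_variation g < \<infinity>"
    and g_var: "circle_variation g < ereal (1 / (8 * C * R\<^sub>2) * \<eta>)"
    and fg_roof: "\<exists>c'>0. \<forall>x. c' \<le> f x + g x"
  shows "\<exists>P'. compact P' \<and> P' \<subseteq> UNIV - {0} \<and>
           cocycle_ratner (rotation \<alpha>) (\<lambda>x. f x + g x) P'"
proof -
  let ?T = "rotation \<alpha>"
  have bdd: "bdd_above ((\<lambda>n. real_of_int (partial_quotient \<alpha> n)) ` {1..})"
  proof -
    obtain b where "\<And>n. n \<in> {1..} \<Longrightarrow> partial_quotient \<alpha> n \<le> b"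
      using bounded_quotients by (auto simp: bdd_above_def)
    then show ?thesis
      by (intro bdd_aboveI2[where M = "of_int b"]) auto
  qed
  have quot: "real_of_int (partial_quotient \<alpha> (Suc n)) \<le> C - 1" for n
    unfolding C using cSUP_upper[OF _ bdd, of "Suc n"] by simp
  have C2: "2 \<le> C"
    using quot[of 0] partial_quotient_ge_1[OF irrational, of 0] by linarith
  have ba: "1 \<le> 2 * C * real j * nearest_int_dist (real j * \<alpha>)" if "1 \<le> j" for j
  proof -
    have "1 \<le> (C - 1 + 2) * real j * nearest_int_dist (real j * \<alpha>)"
      by (rule bounded_type_badly_approximable[OF irrational quot that])
    also have "\<dots> \<le> 2 * C * real j * nearest_int_dist (real j * \<alpha>)"
      using C2 by (intro mult_right_mono) (auto simp: nearest_int_dist_nonneg)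
    finally show ?thesis .
  qed
  (* The trivial partition shows that the variation is not negative, hence a real number. *)
  have "ereal (\<Sum>k<1. \<bar>g (to_circle (real (Suc k))) - g (to_circle (real k))\<bar>) \<le> circle_variation g"
    unfolding circle_variation_def by (intro SUP_upper2[of "(1, real)"]) (auto simp: mono_on_def)
  then have V0: "0 \<le> circle_variation g"
    by (rule order_trans[rotated]) simp
  then obtain V where V: "circle_variation g = ereal V" "0 \<le> V"
    using g_bv by (cases "circle_variation g") auto
  have small: "4 * (2 * C) * R\<^sub>2 * V \<le> \<eta>"
    using g_var C2 R by (simp add: V field_simps)
  obtain J :: nat where "4 * V / \<eta> < real J"
    using reals_Archimedean2 by blast
  then have J: "4 * V < real J * \<eta>"
    using \<eta> by (simp add: field_simps)
  define W where "W = (2 * C * (2 * (real J + 1) * R\<^sub>2) + 1) * V"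
  have W0: "0 \<le> W" using C2 R V by (simp add: W_def)
  obtain B where B: "\<And>p. p \<in> P \<Longrightarrow> \<bar>p\<bar> \<le> B"
    using compact_imp_bounded[OF P(1)] by (auto simp: bounded_iff)
  have P\<eta>: "\<eta> \<le> \<bar>p\<bar>" if "p \<in> P" for p
  proof -
    have "p \<notin> {- \<eta><..<\<eta>}" using \<eta>(3) that by blast
    then show ?thesis by (auto simp: abs_if)
  qed
  define P' where "P' = {q. \<eta> / 16 \<le> \<bar>q\<bar> \<and> \<bar>q\<bar> \<le> B + \<eta> + W}"
  have "P' = cball 0 (B + \<eta> + W) \<inter> {q. \<eta> / 16 \<le> \<bar>q\<bar>}"
    by (auto simp: P'_def)
  moreover have "closed {q::real. \<eta> / 16 \<le> \<bar>q\<bar>}"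
    by (intro closed_Collect_le continuous_intros)
  ultimately have compact: "compact P'"
    by (simp add: compact_Int_closed)
  have nonzero: "P' \<subseteq> UNIV - {0}"
    using \<eta> by (auto simp: P'_def)
  have "cocycle_ratner ?T (\<lambda>x. f x + g x) P'"
    unfolding cocycle_ratner_def
  proof (intro allI impI)
    fix \<epsilon> :: real
    assume \<epsilon>: "0 < \<epsilon>"
    define \<epsilon>' where "\<epsilon>' = min (\<epsilon> / 2) (\<eta> / 32)"
    have \<epsilon>': "0 < \<epsilon>'" "\<epsilon>' \<le> \<eta> / 32" "2 * \<epsilon>' \<le> \<epsilon>"
      using \<epsilon> \<eta> by (auto simp: \<epsilon>'_def)
    obtain \<kappa>0 where \<kappa>0: "0 < \<kappa>0" and ratner:
      "\<forall>N::nat. \<exists>\<delta>>0. \<forall>x x'. 0 < dist x x' \<and> dist x x' < \<delta> \<longrightarrow>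
         (\<exists>M\<ge>N. \<exists>L\<ge>N. \<exists>p\<in>P. \<kappa>0 \<le> real L / real M \<and>
            R\<^sub>1 \<le> real M * dist x x' \<and> real M * dist x x' \<le> R\<^sub>2 \<and>
            (\<forall>n\<in>{M..M + L}. \<bar>birkhoff_sum ?T f n x - birkhoff_sum ?T f n x' - p\<bar> < \<epsilon>'))"
      using f_ratner[unfolded strong_cocycle_ratner_def, THEN spec, THEN mp, OF \<epsilon>'(1)]
      by (elim exE conjE) (rule that)
    define \<kappa> where "\<kappa> = min \<kappa>0 1"
    have \<kappa>: "0 < \<kappa>" "\<kappa> \<le> 1" "\<kappa> \<le> \<kappa>0" using \<kappa>0 by (auto simp: \<kappa>_def)
    obtain K :: nat where "W / \<epsilon>' < real K"
      using reals_Archimedean2 by blast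
    then have K: "W \<le> real K * \<epsilon>'" "0 < K"
      using \<epsilon>' W0 by (auto simp: field_simps intro!: gr0I)
    define \<kappa>' where "\<kappa>' = \<kappa> * R\<^sub>1 / (4 * real K * (real J + 1) * R\<^sub>2)"
    have \<kappa>': "0 < \<kappa>'" using \<kappa> R K by (simp add: \<kappa>'_def)
    show "\<exists>\<kappa>>0. \<forall>N::nat. \<exists>\<delta>>0. \<exists>Z\<in>sets borel. measure circle_lborel Z > 1 - \<epsilon> \<and>
       (\<forall>x\<in>Z. \<forall>x'\<in>Z. 0 < dist x x' \<and> dist x x' < \<delta> \<longrightarrow>
          (\<exists>M\<ge>N. \<exists>L\<ge>N. \<exists>p\<in>P'. real L / real M \<ge> \<kappa> \<and>
             real (card {n \<in> {M..M + L}. \<bar>birkhoff_sum ?T (\<lambda>x. f x + g x) n x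
                     - birkhoff_sum ?T (\<lambda>x. f x + g x) n x' - p\<bar> < \<epsilon>}) / real L > 1 - \<epsilon>))"
    proof (rule exI[of _ \<kappa>'], rule conjI[OF \<kappa>'], rule allI)
      fix N0 :: nat
      (* N >= 1 excludes empty windows and the quotients by zero. *)
      define N where "N = Suc N0"
      obtain \<delta> where \<delta>: "0 < \<delta>" and pair: "\<forall>x x'. 0 < dist x x' \<and> dist x x' < \<delta> \<longrightarrow>
         (\<exists>M\<ge>N * K. \<exists>L\<ge>N * K. \<exists>p\<in>P. \<kappa>0 \<le> real L / real M \<and>
            R\<^sub>1 \<le> real M * dist x x' \<and> real M * dist x x' \<le> R\<^sub>2 \<and>
            (\<forall>n\<in>{M..M + L}. \<bar>birkhoff_sum ?T f n x - birkhoff_sum ?T f n x' - p\<bar> < \<epsilon>'))"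
        using ratner[THEN spec, of "N * K"] by (elim exE conjE) (rule that)
      have good: "\<exists>M\<ge>N0. \<exists>L\<ge>N0. \<exists>p\<in>P'. real L / real M \<ge> \<kappa>' \<and>
             real (card {n \<in> {M..M + L}. \<bar>birkhoff_sum ?T (\<lambda>x. f x + g x) n x
                     - birkhoff_sum ?T (\<lambda>x. f x + g x) n x' - p\<bar> < \<epsilon>}) / real L > 1 - \<epsilon>"
        if close: "0 < dist x x'" "dist x x' < \<delta>" for x x'
      proof -
        define d where "d = dist x x'"
        define D where "D h n = birkhoff_sum ?T h n x - birkhoff_sum ?T h n x'" for h n
        have var: "(\<Sum>k<m. \<bar>D g (Suc k) - D g k\<bar>) \<le> (2 * C * d * real m + 1) * V" for m
          using orbit_variation[OF V(1) _ ba, of x x' d m] C2 close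
          by (simp add: D_def birkhoff_sum_def d_def)
        have window: "\<exists>M\<ge>N * K. \<exists>L\<ge>N * K. \<exists>p. \<eta> \<le> \<bar>p\<bar> \<and> \<bar>p\<bar> \<le> B \<and> \<kappa> * real M \<le> real L \<and>
            R\<^sub>1 \<le> real M * d \<and> real M * d \<le> R\<^sub>2 \<and>
            (\<forall>n\<in>{M..M + L}. \<bar>D f (m + n) - D f m - p\<bar> < \<epsilon>')" for m
        proof -
          have dm: "dist ((?T ^^ m) x) ((?T ^^ m) x') = d"
            by (simp add: d_def dist_rotation_funpow)
          obtain M L p where M: "N * K \<le> M" "N * K \<le> L" and p: "p \<in> P" and L: "\<kappa>0 \<le> real L / real M"
            and Md: "R\<^sub>1 \<le> real M * d" "real M * d \<le> R\<^sub>2"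
            and F: "\<forall>n\<in>{M..M + L}. \<bar>birkhoff_sum ?T f n ((?T ^^ m) x)
                       - birkhoff_sum ?T f n ((?T ^^ m) x') - p\<bar> < \<epsilon>'"
            using pair[THEN spec, THEN spec, THEN mp, of "(?T ^^ m) x" "(?T ^^ m) x'"] close
            unfolding dm d_def[symmetric] by (auto elim: that)
          have "0 < real M" using M K by (auto simp: N_def intro!: gr0I)
          then have "\<kappa>0 * real M \<le> real L" using L by (simp add: field_simps)
          moreover have "\<kappa> * real M \<le> \<kappa>0 * real M" using \<kappa> by (intro mult_right_mono) auto
          ultimately have "\<kappa> * real M \<le> real L" by linarith
          moreover have "D f (m + n) - D f m
              = birkhoff_sum ?T f n ((?T ^^ m) x) - birkhoff_sum ?T f n ((?T ^^ m) x')" for n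
            by (simp add: D_def birkhoff_sum_add)
          ultimately show ?thesis
            using M p Md F B[OF p] P\<eta>[OF p] by auto
        qed
        obtain a l q where a: "N \<le> a" "N \<le> l" and q: "\<eta> / 16 \<le> \<bar>q\<bar>" "\<bar>q\<bar> \<le> B + \<eta> + W"
          and ratio: "\<kappa>' * real a \<le> real l" and near: "\<And>n. n \<in> {a..a + l} \<Longrightarrow> \<bar>D f n + D g n - q\<bar> < 2 * \<epsilon>'"
          using escaping_window[where F = "D f" and G = "D g" and Q = "2 * C" and d = d and N = N,
              OF \<eta>(1) V(2) _ R _ small J W_def K(1) \<epsilon>'(1,2) K(2) _ \<kappa>(1,2) _ _ var window]
            C2 close by (auto simp: d_def D_def birkhoff_sum_def N_def \<kappa>'_def)
        have near': "\<bar>birkhoff_sum ?T (\<lambda>x. f x + g x) n x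
            - birkhoff_sum ?T (\<lambda>x. f x + g x) n x' - q\<bar> < \<epsilon>" if "n \<in> {a..a + l}" for n
          using near[OF that] \<epsilon>'(3) by (simp add: D_def birkhoff_sum_def sum.distrib algebra_simps)
        then have "{n \<in> {a..a + l}. \<bar>birkhoff_sum ?T (\<lambda>x. f x + g x) n x
            - birkhoff_sum ?T (\<lambda>x. f x + g x) n x' - q\<bar> < \<epsilon>} = {a..a + l}"
          by blast
        moreover have "1 - \<epsilon> < real (card {a..a + l}) / real l"
        proof -
          have "0 < l" using a by (simp add: N_def)
          then have "1 \<le> real (card {a..a + l}) / real l" by simp
          then show ?thesis using \<epsilon> by linarith
        qed
        moreover have "\<kappa>' \<le> real l / real a"
          using ratio a by (simp add: N_def pos_le_divide_eq)
        ultimately show ?thesis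
          using a q by (intro exI[of _ a] exI[of _ l] conjI bexI[of _ q]) (auto simp: N_def P'_def)
      qed
      have "measure circle_lborel UNIV = 1"
        by (simp add: measure_def emeasure_circle_lborel_UNIV)
      then show "\<exists>\<delta>>0. \<exists>Z\<in>sets borel. measure circle_lborel Z > 1 - \<epsilon> \<and>
         (\<forall>x\<in>Z. \<forall>x'\<in>Z. 0 < dist x x' \<and> dist x x' < \<delta> \<longrightarrow>
            (\<exists>M\<ge>N0. \<exists>L\<ge>N0. \<exists>p\<in>P'. real L / real M \<ge> \<kappa>' \<and>
               real (card {n \<in> {M..M + L}. \<bar>birkhoff_sum ?T (\<lambda>x. f x + g x) n x
                       - birkhoff_sum ?T (\<lambda>x. f x + g x) n x' - p\<bar> < \<epsilon>}) / real L > 1 - \<epsilon>))"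
        using \<delta> \<epsilon> good by (intro exI[of _ \<delta>] conjI bexI[of _ UNIV]) auto
    qed
  qed
  with compact nonzero show ?thesis by blast
qed

end
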